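(* Let $\mathbf{X}=(X_{1},\ldots,X_{n})^{T}$ and $\mathbf{Y}=(Y_{1},\ldots,Y_{n})^{T}$ be $n\times1$ random vectors and let $\boldsymbol{p},\boldsymbol{q}\in(0,1)^{n}$ with $p_{k}<q_{k}$, $k=1,\ldots,n$; assume that the quantities below are well defined. Then: (i) (Positive homogeneity) for any constant $c>0$, $\mathrm{MRVaR}_{(\boldsymbol{p},\boldsymbol{q})}(c\mathbf{X})=c\,\mathrm{MRVaR}_{(\boldsymbol{p},\boldsymbol{q})}(\mathbf{X})$; (ii) (Translation invariance) for any constant vector $\boldsymbol{\gamma}\in\mathbb{R}^{n}$, $\mathrm{MRVaR}_{(\boldsymbol{p},\boldsymbol{q})}(\mathbf{X}+\boldsymbol{\gamma})=\mathrm{MRVaR}_{(\boldsymbol{p},\boldsymbol{q})}(\mathbf{X})+\boldsymbol{\gamma}$; (iii) (Independence of risks) if $\mathbf{X}$ has independent components, then $\mathrm{MRVaR}_{(\boldsymbol{p},\boldsymbol{q})}(\mathbf{X})=(\mathrm{RVaR}_{(p_{1},q_{1})}(X_{1}),\ldots,\mathrm{RVaR}_{(p_{n},q_{n})}(X_{n}))^{T}$; (iv) (Monotonicity) if $\mathbf{Y}\ge\mathbf{X}$ almost surely (componentwise), then $\mathrm{MRVaR}_{(\boldsymbol{p},\boldsymbol{q})}(\mathbf{Y}-\mathbf{X})\ge\boldsymbol{0}$ componentwise, where $\boldsymbol{0}$ is the vector of $n$ zeros.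
   Context: $\mathrm{VaR}_{p}(X)=\inf\{x: P(X\le x)\ge p\}$ and $\mathrm{VaR}_{\boldsymbol{p}}(\mathbf{X})=(\mathrm{VaR}_{p_{1}}(X_{1}),\ldots,\mathrm{VaR}_{p_{n}}(X_{n}))^{T}$. Inequalities between vectors are componentwise. For a random variable $X$ and $0<p<q<1$, $\mathrm{RVaR}_{(p,q)}(X)=\mathrm{E}[X\mid \mathrm{VaR}_{p}(X)\le X\le\mathrm{VaR}_{q}(X)]$. For a random vector, $\mathrm{MRVaR}_{(\boldsymbol{p},\boldsymbol{q})}(\mathbf{X})=\mathrm{E}[\mathbf{X}\mid \mathrm{VaR}_{\boldsymbol{p}}(\mathbf{X})\le\mathbf{X}\le\mathrm{VaR}_{\boldsymbol{q}}(\mathbf{X})]$ (an $n$-vector). "Well defined" means that the conditioning events involved have positive probability and the conditional expectations are finite. *)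

theory Defs
  imports "HOL-Probability.Probability"
begin

text \<open>
  Conditional expectation given an event \<open>A\<close> is the integral with respect to
  \<^const>\<open>uniform_measure\<close> \<open>M A\<close>, i.e. \<open>M\<close> conditioned on \<open>A\<close> with density \<open>1\<^sub>A / P(A)\<close>.
  It carries its intended meaning only under \<open>event_expectation_defined\<close>.
\<close>

definition event_expectation ::
    "'a measure \<Rightarrow> ('a \<Rightarrow> 'b::{banach, second_countable_topology}) \<Rightarrow> 'a set \<Rightarrow> 'b"
  where "event_expectation M X A = (\<integral>\<omega>. X \<omega> \<partial>(uniform_measure M A))"

definition event_expectation_defined ::
    "'a measure \<Rightarrow> ('a \<Rightarrow> 'b::{banach, second_countable_topology}) \<Rightarrow> 'a set \<Rightarrow> bool"
  where "event_expectation_defined M X A \<longleftrightarrow>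
    measure M A > 0 \<and> integrable (uniform_measure M A) X"

text \<open>
  For \<open>0 < p < 1\<close> and a real random variable on a probability space the set below is nonempty
  and bounded below, so the real-valued \<^const>\<open>Inf\<close> is the genuine infimum.
\<close>

definition VaR :: "'a measure \<Rightarrow> real \<Rightarrow> ('a \<Rightarrow> real) \<Rightarrow> real"
  where "VaR M p X = Inf {x. \<P>(\<omega> in M. X \<omega> \<le> x) \<ge> p}"

definition MVaR :: "'a measure \<Rightarrow> real ^ 'n \<Rightarrow> ('a \<Rightarrow> real ^ 'n) \<Rightarrow> real ^ 'n"
  where "MVaR M p X = (\<chi> k. VaR M (p $ k) (\<lambda>\<omega>. X \<omega> $ k))"

definition RVaR_event :: "'a measure \<Rightarrow> real \<Rightarrow> real \<Rightarrow> ('a \<Rightarrow> real) \<Rightarrow> 'a set"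
  where "RVaR_event M p q X = {\<omega> \<in> space M. VaR M p X \<le> X \<omega> \<and> X \<omega> \<le> VaR M q X}"

definition RVaR :: "'a measure \<Rightarrow> real \<Rightarrow> real \<Rightarrow> ('a \<Rightarrow> real) \<Rightarrow> real"
  where "RVaR M p q X = event_expectation M X (RVaR_event M p q X)"

definition RVaR_defined :: "'a measure \<Rightarrow> real \<Rightarrow> real \<Rightarrow> ('a \<Rightarrow> real) \<Rightarrow> bool"
  where "RVaR_defined M p q X \<longleftrightarrow> event_expectation_defined M X (RVaR_event M p q X)"

text \<open>The order on \<^typ>\<open>real ^ 'n\<close> is the componentwise one (\<open>less_eq_vec_def\<close>).\<close>

definition MRVaR_event ::
    "'a measure \<Rightarrow> real ^ 'n \<Rightarrow> real ^ 'n \<Rightarrow> ('a \<Rightarrow> real ^ 'n) \<Rightarrow> 'a set"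
  where "MRVaR_event M p q X = {\<omega> \<in> space M. MVaR M p X \<le> X \<omega> \<and> X \<omega> \<le> MVaR M q X}"

definition MRVaR ::
    "'a measure \<Rightarrow> real ^ 'n \<Rightarrow> real ^ 'n \<Rightarrow> ('a \<Rightarrow> real ^ 'n) \<Rightarrow> real ^ 'n"
  where "MRVaR M p q X = event_expectation M X (MRVaR_event M p q X)"

definition MRVaR_defined ::
    "'a measure \<Rightarrow> real ^ 'n \<Rightarrow> real ^ 'n \<Rightarrow> ('a \<Rightarrow> real ^ 'n) \<Rightarrow> bool"
  where "MRVaR_defined M p q X \<longleftrightarrow> event_expectation_defined M X (MRVaR_event M p q X)"

end

theory Submission
  imports Defs
begin

text \<open>
  Everything rests on three facts about \<open>E[X | A] = E[1\<^sub>A X] / P(A)\<close>: it is linear and fixes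
  constants, it acts componentwise on vectors, and it preserves almost sure nonnegativity.

  Positive homogeneity and translation invariance are the two halves of one statement about
  increasing affine maps \<open>x \<mapsto> c x + b\<close>. Quantiles commute with such a map
  (\<open>VaR_affine\<close>), so it carries the box bounded by the quantile vectors of \<open>X\<close> onto the box
  belonging to \<open>c X + b\<close>: both vectors are conditioned on the same event
  (\<open>MRVaR_event_affine\<close>), and linearity finishes the argument.

  For independent components, the conditioning event is an intersection of events
  \<open>X\<^sub>j \<in> B\<^sub>j\<close>, one for each coordinate. Numerator and denominator of
  \<open>E[X\<^sub>k | \<forall>j. X\<^sub>j \<in> B\<^sub>j]\<close> both contain the factor \<open>\<Prod>\<^bsub>j \<noteq> k\<^esub> P(X\<^sub>j \<in> B\<^sub>j)\<close>, which
  cancels and leaves \<open>E[X\<^sub>k | X\<^sub>k \<in> B\<^sub>k]\<close> (\<open>event_expectation_indep\<close>).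

  Monotonicity holds because \<open>Y - X\<close> is almost surely nonnegative, and remains so under every
  conditional measure.
\<close>

section \<open>Expectation conditional on an event\<close>

text \<open>
  Rewriting a Bochner integral with respect to a density as one with respect to \<open>M\<close> needs a density
  that embeds a real function, whereas \<^const>\<open>uniform_measure\<close> divides extended nonnegative reals. The two agree when the
  event has positive measure.
\<close>

lemma (in finite_measure) uniform_measure_eq_density_real:
  assumes "measure M A > 0"
  shows "uniform_measure M A = density M (\<lambda>\<omega>. ennreal (indicator A \<omega> / measure M A))"
  using assms unfolding uniform_measure_def emeasure_eq_measure
  by (intro arg_cong[of _ _ "density M"] ext) (auto simp: divide_ennreal simp flip: ennreal_1 split: split_indicator)

lemma (in finite_measure) event_expectation_eq:
  assumes "X \<in> borel_measurable M" "A \<in> sets M" "measure M A > 0"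
  shows "event_expectation M X A = (\<integral>\<omega>. indicator A \<omega> *\<^sub>R X \<omega> \<partial>M) /\<^sub>R measure M A"
proof -
  have "event_expectation M X A = (\<integral>\<omega>. (indicator A \<omega> / measure M A) *\<^sub>R X \<omega> \<partial>M)"
    unfolding event_expectation_def uniform_measure_eq_density_real[OF assms(3)]
    using assms by (intro integral_density) auto
  also have "\<dots> = (\<integral>\<omega>. (indicator A \<omega> *\<^sub>R X \<omega>) /\<^sub>R measure M A \<partial>M)"
    by (simp add: divide_inverse_commute)
  finally show ?thesis
    by (simp only: integral_scaleR_right)
qed

lemma (in finite_measure) event_expectation_defined_integrable:
  assumes "X \<in> borel_measurable M" "A \<in> sets M" "event_expectation_defined M X A"
  shows "integrable M (\<lambda>\<omega>. indicator A \<omega> *\<^sub>R X \<omega>)"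
proof -
  have pos: "measure M A > 0" and "integrable (uniform_measure M A) X"
    using assms(3) by (auto simp: event_expectation_defined_def)
  then have "integrable M (\<lambda>\<omega>. (indicator A \<omega> / measure M A) *\<^sub>R X \<omega>)"
    unfolding uniform_measure_eq_density_real[OF pos]
    using assms by (subst (asm) integrable_density) auto
  then have "integrable M (\<lambda>\<omega>. measure M A *\<^sub>R (indicator A \<omega> / measure M A) *\<^sub>R X \<omega>)"
    by (rule integrable_scaleR_right)
  with pos show ?thesis by simp
qed

text \<open>
  The constant \<open>b\<close> comes out unchanged because conditioning on an event of positive measure gives a
  probability measure.
\<close>

lemma (in finite_measure) event_expectation_affine:
  assumes "A \<in> sets M" "event_expectation_defined M X A"
  shows "event_expectation M (\<lambda>\<omega>. c *\<^sub>R X \<omega> + b) A = c *\<^sub>R event_expectation M X A + b"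
proof -
  have pos: "measure M A > 0" and int: "integrable (uniform_measure M A) X"
    using assms(2) by (auto simp: event_expectation_defined_def)
  interpret U: prob_space "uniform_measure M A"
    using pos by (intro prob_space_uniform_measure) (auto simp: emeasure_eq_measure)
  show ?thesis
    using int U.prob_space by (simp add: event_expectation_def)
qed

lemma event_expectation_component:
  fixes X :: "'a \<Rightarrow> real ^ 'n"
  assumes "event_expectation_defined M X A"
  shows "event_expectation M X A $ k = event_expectation M (\<lambda>\<omega>. X \<omega> $ k) A"
  using assms unfolding event_expectation_def event_expectation_defined_def
  by (simp add: integral_bounded_linear[OF bounded_linear_vec_nth])

lemma event_expectation_nonneg:
  fixes Z :: "'a \<Rightarrow> real ^ 'n"
  assumes "A \<in> sets M" "event_expectation_defined M Z A" "AE \<omega> in M. 0 \<le> Z \<omega>"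
  shows "0 \<le> event_expectation M Z A"
  unfolding less_eq_vec_def
proof
  fix k
  have "AE \<omega> in uniform_measure M A. 0 \<le> Z \<omega> $ k"
    using assms(3) by (intro AE_uniform_measureI[OF assms(1)]) (auto simp: less_eq_vec_def)
  then show "0 $ k \<le> event_expectation M Z A $ k"
    unfolding event_expectation_component[OF assms(2)] unfolding event_expectation_def
    by (simp only: zero_index integral_nonneg_AE)
qed

section \<open>Quantiles under increasing affine maps\<close>

text \<open>
  The set whose infimum is the quantile of \<open>c X + b\<close> is the image of the one for \<open>X\<close>, and an
  increasing continuous map commutes with infima. The infimum of a set of reals is meaningful only if
  the set is nonempty and bounded below; here this holds because the distribution function tends
  to \<open>1 > p\<close> and to \<open>0 < p\<close> at the two ends of the line.
\<close>

lemma (in prob_space) VaR_affine: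
  fixes X :: "'a \<Rightarrow> real"
  assumes X[measurable]: "X \<in> borel_measurable M" and p: "p \<in> {0<..<1}" and c: "c > 0"
  shows "VaR M p (\<lambda>\<omega>. c * X \<omega> + b) = c * VaR M p X + b"
proof -
  define F where "F x = prob {\<omega> \<in> space M. X \<omega> \<le> x}" for x
  define S where "S = {x. F x \<ge> p}"
  interpret D: real_distribution "distr M borel X" by (rule real_distribution_distr) simp
  have F: "cdf (distr M borel X) = F"
    by (auto simp: fun_eq_iff cdf_def F_def measure_distr intro!: arg_cong[of _ _ prob])
  have "eventually (\<lambda>x. F x > p) at_top"
    using order_tendstoD(1)[OF D.cdf_lim_at_top_prob] p by (simp add: F)
  then have "S \<noteq> {}"
    unfolding S_def eventually_at_top_linorder by (metis (mono_tags) empty_iff less_imp_le mem_Collect_eq order_refl)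
  moreover have "bdd_below S"
  proof -
    have "eventually (\<lambda>x. F x < p) at_bot"
      using order_tendstoD(2)[OF D.cdf_lim_at_bot] p by (simp add: F)
    then obtain l where "\<And>x. x \<le> l \<Longrightarrow> F x < p"
      unfolding eventually_at_bot_linorder by blast
    then show ?thesis
      unfolding S_def by (intro bdd_belowI[of _ l]) (metis linorder_le_cases mem_Collect_eq not_less)
  qed
  moreover have "{x. prob {\<omega> \<in> space M. c * X \<omega> + b \<le> x} \<ge> p} = (\<lambda>x. c * x + b) ` S"
  proof -
    have "{x. prob {\<omega> \<in> space M. c * X \<omega> + b \<le> x} \<ge> p} = (\<lambda>x. (x - b) / c) -` S"
      using c by (auto simp: S_def F_def field_simps)
    also have "\<dots> = (\<lambda>x. c * x + b) ` S"
    proof (intro set_eqI iffI)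
      fix x assume "x \<in> (\<lambda>x. (x - b) / c) -` S"
      then show "x \<in> (\<lambda>x. c * x + b) ` S"
        using c by (intro image_eqI[of _ _ "(x - b) / c"]) auto
    qed (use c in auto)
    finally show ?thesis .
  qed
  moreover have "mono (\<lambda>x. c * x + b)" using c by (auto simp: mono_def)
  moreover have "continuous (at_right (Inf S)) (\<lambda>x. c * x + b)"
    by (intro continuous_intros)
  ultimately show ?thesis
    using continuous_at_Inf_mono[of "\<lambda>x. c * x + b" S]
    by (simp add: VaR_def F_def[symmetric] S_def[symmetric])
qed

lemma borel_measurable_vec_nth:
  fixes X :: "'a \<Rightarrow> real ^ 'n"
  assumes "X \<in> borel_measurable M"
  shows "(\<lambda>\<omega>. X \<omega> $ k) \<in> borel_measurable M"
  using assms by (rule borel_measurable_continuous_on[rotated]) (intro continuous_intros)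

lemma (in prob_space) MVaR_affine:
  fixes X :: "'a \<Rightarrow> real ^ 'n"
  assumes "X \<in> borel_measurable M" "\<And>k. p $ k \<in> {0<..<1}" "c > 0"
  shows "MVaR M p (\<lambda>\<omega>. c *\<^sub>R X \<omega> + b) = c *\<^sub>R MVaR M p X + b"
  using assms by (simp add: MVaR_def vec_eq_iff VaR_affine borel_measurable_vec_nth)

text \<open>
  Since \<open>x \<mapsto> c x + b\<close> is an order isomorphism in each coordinate, moving the vector and its
  quantiles together leaves the inequalities that define the event unchanged.
\<close>

lemma (in prob_space) MRVaR_event_affine:
  fixes X :: "'a \<Rightarrow> real ^ 'n"
  assumes "X \<in> borel_measurable M" "\<And>k. p $ k \<in> {0<..<1}" "\<And>k. q $ k \<in> {0<..<1}" "c > 0"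
  shows "MRVaR_event M p q (\<lambda>\<omega>. c *\<^sub>R X \<omega> + b) = MRVaR_event M p q X"
  using assms by (auto simp: MRVaR_event_def MVaR_affine less_eq_vec_def)

text \<open>
  The event has the product shape to which independence of the components applies.
\<close>

lemma MRVaR_event_eq_components:
  fixes X :: "'a \<Rightarrow> real ^ 'n"
  shows "MRVaR_event M p q X = {\<omega> \<in> space M. \<forall>k\<in>UNIV. X \<omega> $ k \<in>
    {VaR M (p $ k) (\<lambda>\<omega>. X \<omega> $ k)..VaR M (q $ k) (\<lambda>\<omega>. X \<omega> $ k)}}"
  by (auto simp: MRVaR_event_def less_eq_vec_def MVaR_def)

lemma sets_MRVaR_event:
  fixes X :: "'a \<Rightarrow> real ^ 'n"
  assumes "X \<in> borel_measurable M"
  shows "MRVaR_event M p q X \<in> sets M"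
proof -
  have [measurable]: "(\<lambda>\<omega>. X \<omega> $ k) \<in> borel_measurable M" for k
    using assms by (rule borel_measurable_vec_nth)
  show ?thesis unfolding MRVaR_event_eq_components by measurable
qed

lemma (in prob_space) MRVaR_affine:
  fixes X :: "'a \<Rightarrow> real ^ 'n"
  assumes "X \<in> borel_measurable M" "\<And>k. p $ k \<in> {0<..<1}" "\<And>k. q $ k \<in> {0<..<1}" "c > 0"
    and "MRVaR_defined M p q X"
  shows "MRVaR M p q (\<lambda>\<omega>. c *\<^sub>R X \<omega> + b) = c *\<^sub>R MRVaR M p q X + b"
  using assms
  by (simp add: MRVaR_def MRVaR_defined_def MRVaR_event_affine event_expectation_affine
      sets_MRVaR_event)

section \<open>Independent components\<close>

text \<open>
  Constraints on the other, independent, variables do not change a conditional expectation: writing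
  \<open>A\<^sub>j\<close> for the event \<open>X\<^sub>j \<in> B\<^sub>j\<close> and \<open>E\<close> for their intersection,
  \<open>E[1\<^sub>E X\<^sub>k] = E[1\<^bsub>A\<^sub>k\<^esub> X\<^sub>k] \<Prod>\<^bsub>j \<noteq> k\<^esub> P(A\<^sub>j)\<close> and
  \<open>P(E) = P(A\<^sub>k) \<Prod>\<^bsub>j \<noteq> k\<^esub> P(A\<^sub>j)\<close>, and the common product is nonzero because \<open>P(E)\<close> is.
\<close>

lemma (in prob_space) event_expectation_indep:
  fixes X :: "'i \<Rightarrow> 'a \<Rightarrow> real"
  assumes fin: "finite I" and indep: "indep_vars (\<lambda>_. borel) X I" and k: "k \<in> I"
    and B[measurable]: "\<And>j. j \<in> I \<Longrightarrow> B j \<in> sets borel"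
    and pos: "prob {\<omega> \<in> space M. \<forall>j\<in>I. X j \<omega> \<in> B j} > 0"
    and def: "event_expectation_defined M (X k) {\<omega> \<in> space M. X k \<omega> \<in> B k}"
  shows "event_expectation M (X k) {\<omega> \<in> space M. \<forall>j\<in>I. X j \<omega> \<in> B j} =
    event_expectation M (X k) {\<omega> \<in> space M. X k \<omega> \<in> B k}"
proof -
  define A where "A j = {\<omega> \<in> space M. X j \<omega> \<in> B j}" for j
  define E where "E = {\<omega> \<in> space M. \<forall>j\<in>I. X j \<omega> \<in> B j}"
  have X[measurable]: "X j \<in> borel_measurable M" if "j \<in> I" for j
    using indep that by (auto simp: indep_vars_def)
  have A: "A j \<in> sets M" if "j \<in> I" for j
    using that unfolding A_def by measurable
  have E: "E \<in> sets M" using fin unfolding E_def by measurable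
  have int: "integrable M (\<lambda>\<omega>. indicator (A k) \<omega> * X k \<omega>)"
    using event_expectation_defined_integrable[OF X[OF k] A[OF k]] def by (simp add: A_def)
  \<comment> \<open>The numerator is the case of the identity \<open>h\<close>, the denominator that of \<open>h = 1\<close>.\<close>
  have prod: "(\<integral>\<omega>. indicator E \<omega> * h (X k \<omega>) \<partial>M) =
      (\<integral>\<omega>. indicator (A k) \<omega> * h (X k \<omega>) \<partial>M) * (\<Prod>j\<in>I - {k}. prob (A j))"
    if [measurable]: "h \<in> borel_measurable borel"
      and h: "integrable M (\<lambda>\<omega>. indicator (A k) \<omega> * h (X k \<omega>))" for h :: "real \<Rightarrow> real"
  proof -
    \<comment> \<open>Attaching \<open>h (X k)\<close> to the \<open>k\<close>-th indicator turns the integrand into a product with one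
      factor for each independent variable.\<close>
    define g where "g j x = indicator (B j) x * (if j = k then h x else 1)" for j x
    have g: "g j (X j \<omega>) = indicator (A j) \<omega> * (if j = k then h (X k \<omega>) else 1)"
      if "\<omega> \<in> space M" for j \<omega>
      using that by (auto simp: g_def A_def split: split_indicator)
    have "(\<integral>\<omega>. indicator E \<omega> * h (X k \<omega>) \<partial>M) = (\<integral>\<omega>. (\<Prod>j\<in>I. g j (X j \<omega>)) \<partial>M)"
    proof (intro Bochner_Integration.integral_cong refl)
      fix \<omega> assume \<omega>: "\<omega> \<in> space M"
      have "indicator E \<omega> = (\<Prod>j\<in>I. indicator (A j) \<omega> :: real)"
        using \<omega> fin by (auto simp: E_def A_def prod_zero_iff split: split_indicator)
      then show "indicator E \<omega> * h (X k \<omega>) = (\<Prod>j\<in>I. g j (X j \<omega>))"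
        using fin k by (simp add: g[OF \<omega>] prod.distrib prod.delta)
    qed
    also have "\<dots> = (\<Prod>j\<in>I. \<integral>\<omega>. g j (X j \<omega>) \<partial>M)"
    proof (rule indep_vars_lebesgue_integral[OF fin])
      show "indep_vars (\<lambda>_. borel) (\<lambda>j \<omega>. g j (X j \<omega>)) I"
        by (rule indep_vars_compose2[OF indep]) (auto simp: g_def[abs_def])
      show "integrable M (\<lambda>\<omega>. g j (X j \<omega>))" if "j \<in> I" for j
        using A[OF that] h
        by (subst Bochner_Integration.integrable_cong[OF refl g])
           (cases "j = k"; auto intro!: integrable_real_indicator simp: emeasure_eq_measure)+
    qed
    also have "\<dots> = (\<integral>\<omega>. g k (X k \<omega>) \<partial>M) * (\<Prod>j\<in>I - {k}. \<integral>\<omega>. g j (X j \<omega>) \<partial>M)"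
      by (rule prod.remove[OF fin k])
    also have "\<dots> = (\<integral>\<omega>. indicator (A k) \<omega> * h (X k \<omega>) \<partial>M) * (\<Prod>j\<in>I - {k}. prob (A j))"
      using A by (intro arg_cong2[of _ _ _ _ "(*)"] prod.cong refl)
        (auto simp: g cong: Bochner_Integration.integral_cong)
    finally show ?thesis .
  qed
  have PE: "prob E = prob (A k) * (\<Prod>j\<in>I - {k}. prob (A j))"
    using prod[of "\<lambda>_. 1"] A[OF k] E by (simp add: integrable_real_indicator emeasure_eq_measure)
  with pos have "(\<Prod>j\<in>I - {k}. prob (A j)) \<noteq> 0"
    unfolding E_def[symmetric] by auto
  with PE show ?thesis
    using pos def prod[of "\<lambda>x. x"] int unfolding E_def[symmetric] A_def[symmetric]
    by (auto simp: event_expectation_eq X A E k event_expectation_defined_def)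
qed

lemma (in prob_space) MRVaR_indep:
  fixes X :: "'a \<Rightarrow> real ^ 'n"
  assumes indep: "indep_vars (\<lambda>_. borel) (\<lambda>k \<omega>. X \<omega> $ k) UNIV"
    and def: "MRVaR_defined M p q X"
    and def_k: "\<And>k. RVaR_defined M (p $ k) (q $ k) (\<lambda>\<omega>. X \<omega> $ k)"
  shows "MRVaR M p q X = (\<chi> k. RVaR M (p $ k) (q $ k) (\<lambda>\<omega>. X \<omega> $ k))"
proof -
  define B where "B k = {VaR M (p $ k) (\<lambda>\<omega>. X \<omega> $ k)..VaR M (q $ k) (\<lambda>\<omega>. X \<omega> $ k)}" for k
  have joint: "MRVaR_event M p q X = {\<omega> \<in> space M. \<forall>k\<in>UNIV. X \<omega> $ k \<in> B k}"
    unfolding MRVaR_event_eq_components B_def ..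
  have marginal: "RVaR_event M (p $ k) (q $ k) (\<lambda>\<omega>. X \<omega> $ k) = {\<omega> \<in> space M. X \<omega> $ k \<in> B k}" for k
    by (simp add: RVaR_event_def B_def)
  have "MRVaR M p q X $ k = RVaR M (p $ k) (q $ k) (\<lambda>\<omega>. X \<omega> $ k)" for k
  proof -
    have "MRVaR M p q X $ k = event_expectation M (\<lambda>\<omega>. X \<omega> $ k) (MRVaR_event M p q X)"
      using def unfolding MRVaR_def MRVaR_defined_def by (rule event_expectation_component)
    also have "\<dots> = RVaR M (p $ k) (q $ k) (\<lambda>\<omega>. X \<omega> $ k)"
      unfolding RVaR_def joint marginal
      using def def_k[of k]
      by (intro event_expectation_indep[OF finite indep])
         (auto simp: MRVaR_defined_def RVaR_defined_def event_expectation_defined_def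
            joint marginal B_def)
    finally show ?thesis .
  qed
  then show ?thesis by (simp add: vec_eq_iff)
qed

section \<open>The properties of multivariate range value-at-risk\<close>

theorem proposition1:
  fixes M :: "'a measure" and X Y :: "'a \<Rightarrow> real ^ 'n" and p q :: "real ^ 'n"
  assumes "prob_space M"
    and "X \<in> borel_measurable M" and "Y \<in> borel_measurable M"
    and "\<And>k. p $ k \<in> {0<..<1}" and "\<And>k. q $ k \<in> {0<..<1}"
    and "\<And>k. p $ k < q $ k"
  shows
    "(\<forall>c::real. c > 0 \<longrightarrow>
        MRVaR_defined M p q X \<longrightarrow> MRVaR_defined M p q (\<lambda>\<omega>. c *\<^sub>R X \<omega>) \<longrightarrow>
        MRVaR M p q (\<lambda>\<omega>. c *\<^sub>R X \<omega>) = c *\<^sub>R MRVaR M p q X) \<and>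
     (\<forall>\<gamma> :: real ^ 'n.
        MRVaR_defined M p q X \<longrightarrow> MRVaR_defined M p q (\<lambda>\<omega>. X \<omega> + \<gamma>) \<longrightarrow>
        MRVaR M p q (\<lambda>\<omega>. X \<omega> + \<gamma>) = MRVaR M p q X + \<gamma>) \<and>
     (prob_space.indep_vars M (\<lambda>_. borel) (\<lambda>k \<omega>. X \<omega> $ k) UNIV \<longrightarrow>
        MRVaR_defined M p q X \<longrightarrow>
        (\<forall>k. RVaR_defined M (p $ k) (q $ k) (\<lambda>\<omega>. X \<omega> $ k)) \<longrightarrow>
        MRVaR M p q X = (\<chi> k. RVaR M (p $ k) (q $ k) (\<lambda>\<omega>. X \<omega> $ k))) \<and>
     ((AE \<omega> in M. X \<omega> \<le> Y \<omega>) \<longrightarrow>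
        MRVaR_defined M p q (\<lambda>\<omega>. Y \<omega> - X \<omega>) \<longrightarrow>
        0 \<le> MRVaR M p q (\<lambda>\<omega>. Y \<omega> - X \<omega>))"
proof -
  interpret prob_space M by fact
  have [measurable]: "X \<in> borel_measurable M" "Y \<in> borel_measurable M" by fact+
  have affine: "MRVaR M p q (\<lambda>\<omega>. c *\<^sub>R X \<omega> + b) = c *\<^sub>R MRVaR M p q X + b"
    if "c > 0" "MRVaR_defined M p q X" for c b
    using assms that by (intro MRVaR_affine)
  have "MRVaR M p q (\<lambda>\<omega>. c *\<^sub>R X \<omega>) = c *\<^sub>R MRVaR M p q X"
    if "c > 0" "MRVaR_defined M p q X" for c
    using affine[OF that, of 0] by simp
  moreover have "MRVaR M p q (\<lambda>\<omega>. X \<omega> + \<gamma>) = MRVaR M p q X + \<gamma>"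
    if "MRVaR_defined M p q X" for \<gamma>
    using affine[of 1 \<gamma>] that by simp
  moreover have "MRVaR M p q X = (\<chi> k. RVaR M (p $ k) (q $ k) (\<lambda>\<omega>. X \<omega> $ k))"
    if "indep_vars (\<lambda>_. borel) (\<lambda>k \<omega>. X \<omega> $ k) UNIV" "MRVaR_defined M p q X"
      "\<forall>k. RVaR_defined M (p $ k) (q $ k) (\<lambda>\<omega>. X \<omega> $ k)"
    using that by (intro MRVaR_indep) auto
  moreover have "0 \<le> MRVaR M p q (\<lambda>\<omega>. Y \<omega> - X \<omega>)"
    if "AE \<omega> in M. X \<omega> \<le> Y \<omega>" "MRVaR_defined M p q (\<lambda>\<omega>. Y \<omega> - X \<omega>)"
    using that unfolding MRVaR_def MRVaR_defined_def
    by (intro event_expectation_nonneg sets_MRVaR_event) (auto simp: less_eq_vec_def)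
  ultimately show ?thesis by blast
qed

end
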